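(* There exists a polygon of an arbitrarily large perimeter $P$, for which the cost of any rendezvous algorithm for two agents with coherent compasses starting at any distance $D>0$, is $\Omega(P)$.
   Context: The scenario is rendezvous without a map. The polygon is a closed polygon in the plane, regarded as a terrain without obstacles. The distance between two points of the terrain is the length of a shortest path between them included in the terrain. Agents: two agents, modeled as points, start at different points of the terrain chosen by the adversary. The terrain is a priori unknown to them (no map). Each has a unit of length and a compass (a direction called North); both use the same clockwise orientation. Compasses are coherent if both agents have the same North. An agent knows whether it is at an interior or a boundary point, and in the latter case the slope(s) of the boundary there; it cannot sense the terrain or the other agent in any vicinity of its location. Routes: a deterministic algorithm makes an agent construct a finite polygonal path in the terrain (its route) in steps. In a step starting at a point, the agent chooses a direction (according to its compass) and a distance; if the segment of this length in this direction does not intersect the boundary, the step ends at the end of this segment, otherwise it ends at the closest boundary point in this direction. If the starting point of the step is on a segment of the boundary, the agent may alternatively follow this segment in either direction until its end or for a given distance. Walks: let the route be $(S_1,\dots,S_k)$ with $S_i=[a_i,a_{i+1}]$. The adversary chooses reals $0=t_1<t_2<\dots<t_{k+1}$ and continuous functions $f_i:[t_i,t_{i+1}]\to[a_i,a_{i+1}]$ with $f_i(t_i)=a_i$, $f_i(t_{i+1})=a_{i+1}$; the walk is $f(t)=f_i(t)$ for $t\in[t_i,t_{i+1}]$, and the agent is inert after $t_{k+1}$. Agents with walks $f_1,f_2$ meet (rendezvous) at time $t$ if $f_1(t)=f_2(t)$. A rendezvous algorithm is a deterministic algorithm guaranteeing that the agents meet regardless of the walks chosen by the adversary. The trajectory of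 an agent is the sequence of segments of its route until rendezvous (the last one possibly being a portion of a route segment). The cost is the worst-case (over adversarial decisions) sum of the lengths of the segments of the trajectories of both agents. *)

theory Defs
  imports "HOL-Analysis.Analysis"
begin

section \<open>Polygonal terrains\<close>

text \<open>A polygon is given by the cyclic list of its vertices in the plane of complex numbers.\<close>

type_synonym polygon = "complex list"

definition edge :: "polygon \<Rightarrow> nat \<Rightarrow> complex \<times> complex" where
  "edge T i = (T ! i, T ! (Suc i mod length T))"

definition edges :: "polygon \<Rightarrow> (complex \<times> complex) set" where
  "edges T = edge T ` {..<length T}"

text \<open>Two different edges share at most common endpoints. Vertices with a straight angle are
  excluded, so that the edges are exactly the maximal segments of the boundary.\<close>

definition simple_polygon :: "polygon \<Rightarrow> bool" where
  "simple_polygon T \<longleftrightarrow>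
     3 \<le> length T \<and> distinct T \<and>
     (\<forall>(a, b)\<in>edges T. \<forall>(c, d)\<in>edges T. (a, b) \<noteq> (c, d) \<longrightarrow>
        closed_segment a b \<inter> closed_segment c d \<subseteq> {a, b} \<inter> {c, d}) \<and>
     (\<forall>a b c. (a, b) \<in> edges T \<and> (b, c) \<in> edges T \<longrightarrow> \<not> collinear {a, b, c})"

definition boundary :: "polygon \<Rightarrow> complex set" where
  "boundary T = (\<Union>(a, b)\<in>edges T. closed_segment a b)"

definition terrain :: "polygon \<Rightarrow> complex set" where
  "terrain T = boundary T \<union> inside (boundary T)"

definition perimeter :: "polygon \<Rightarrow> real" where
  "perimeter T = (\<Sum>(a, b)\<in>edges T. dist a b)"

definition path_length :: "(real \<Rightarrow> complex) \<Rightarrow> ereal" where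
  "path_length g =
     (SUP ts\<in>{ts. sorted ts \<and> set ts \<subseteq> {0..1}}.
        ereal (\<Sum>i<length ts - 1. dist (g (ts ! i)) (g (ts ! Suc i))))"

definition terrain_dist :: "polygon \<Rightarrow> complex \<Rightarrow> complex \<Rightarrow> ereal" where
  "terrain_dist T x y =
     (INF g\<in>{g. path g \<and> path_image g \<subseteq> terrain T \<and> pathstart g = x \<and> pathfinish g = y}.
        path_length g)"


section \<open>Agents\<close>

text \<open>The private equipment of an agent: the direction called North, as a vector of norm 1, and
  the unit of length.\<close>

record frame =
  north :: complex
  unit_length :: real

definition is_frame :: "frame \<Rightarrow> bool" where
  "is_frame f \<longleftrightarrow> cmod (north f) = 1 \<and> 0 < unit_length f"

text \<open>Agents describe directions by angles measured clockwise from their North.\<close>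

definition heading :: "frame \<Rightarrow> real \<Rightarrow> complex" where
  "heading f \<theta> = north f * cis (- \<theta>)"

text \<open>The slopes of the boundary edges through \<open>p\<close>, as angles modulo \<open>\<pi>\<close>. The set is empty
  iff \<open>p\<close> is not on the boundary, so it also tells interior points from boundary points.\<close>

definition slopes :: "frame \<Rightarrow> polygon \<Rightarrow> complex \<Rightarrow> real set" where
  "slopes f T p =
     {\<theta>. 0 \<le> \<theta> \<and> \<theta> < pi \<and>
        (\<exists>(a, b)\<in>edges T. p \<in> closed_segment a b \<and> (\<exists>k. b - a = k *\<^sub>R heading f \<theta>))}"

text \<open>\<open>Move \<theta> r\<close>: go in direction \<open>\<theta>\<close> at distance \<open>r\<close>. \<open>Follow \<theta> (Some r)\<close> and
  \<open>Follow \<theta> None\<close>: follow the boundary edge in direction \<open>\<theta>\<close>, for distance \<open>r\<close> or until the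
  end of the edge. Distances are in the unit of the agent.\<close>

datatype action = Move real real | Follow real "real option"

text \<open>Endpoint of a straight step of length \<open>l\<close> from \<open>p\<close> in direction \<open>d\<close>. A step starting on the
  boundary may cross the interior up to the next boundary point. It is void if \<open>d\<close> leads out of
  the terrain or along the boundary.\<close>

definition move_end :: "polygon \<Rightarrow> complex \<Rightarrow> complex \<Rightarrow> real \<Rightarrow> complex" where
  "move_end T p d l =
     (if 0 < l \<and> (\<exists>e>0. \<forall>s\<in>{0<..<e}. p + s *\<^sub>R d \<in> inside (boundary T))
      then let H = {s. 0 < s \<and> s \<le> l \<and> p + s *\<^sub>R d \<in> boundary T}
           in p + (if H = {} then l else Inf H) *\<^sub>R d
      else p)"

text \<open>The endpoint, in direction \<open>d\<close>, of the edge through \<open>p\<close>. There is at most one, since edges do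
  not overlap.\<close>

definition follow_target :: "polygon \<Rightarrow> complex \<Rightarrow> complex \<Rightarrow> complex \<Rightarrow> bool" where
  "follow_target T p d b \<longleftrightarrow>
     (\<exists>a. ((a, b) \<in> edges T \<or> (b, a) \<in> edges T) \<and> p \<in> closed_segment a b) \<and>
     (\<exists>k>0. b = p + k *\<^sub>R d)"

text \<open>Following is void if no edge leaves \<open>p\<close> in the chosen direction.\<close>

fun step :: "frame \<Rightarrow> polygon \<Rightarrow> complex \<Rightarrow> action \<Rightarrow> complex" where
  "step f T p (Move \<theta> r) = move_end T p (heading f \<theta>) (r * unit_length f)"
| "step f T p (Follow \<theta> ro) =
     (if \<exists>b. follow_target T p (heading f \<theta>) b
      then let b = (THE b. follow_target T p (heading f \<theta>) b)
           in case ro of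
                None \<Rightarrow> b
              | Some r \<Rightarrow> p + min (dist p b) (max 0 (r * unit_length f)) *\<^sub>R heading f \<theta>
      else p)"

text \<open>Everything that an agent has perceived when it reaches the last point of the sequence \<open>vs\<close> of
  endpoints of its steps: for each point, the distance (in its unit) walked in the step leading
  there, and the slopes of the boundary at that point.\<close>

definition history :: "frame \<Rightarrow> polygon \<Rightarrow> complex list \<Rightarrow> (real \<times> real set) list" where
  "history f T vs =
     map (\<lambda>i. (if i = 0 then 0 else dist (vs ! (i - 1)) (vs ! i) / unit_length f,
               slopes f T (vs ! i)))
       [0..<length vs]"

text \<open>A deterministic algorithm maps the history to the next action, or to \<open>None\<close> when the route is
  complete. Both agents execute the same algorithm.\<close>

type_synonym algorithm = "(real \<times> real set) list \<Rightarrow> action option"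

text \<open>\<open>vs\<close> lists the points $a_1, \dots, a_{k+1}$ of the finite route starting at \<open>x\<close>.\<close>

definition is_route :: "algorithm \<Rightarrow> frame \<Rightarrow> polygon \<Rightarrow> complex \<Rightarrow> complex list \<Rightarrow> bool" where
  "is_route A f T x vs \<longleftrightarrow>
     vs \<noteq> [] \<and> hd vs = x \<and>
     (\<forall>i. Suc i < length vs \<longrightarrow>
        (\<exists>act. A (history f T (take (Suc i) vs)) = Some act \<and>
               vs ! Suc i = step f T (vs ! i) act)) \<and>
     A (history f T vs) = None"


section \<open>Walks, rendezvous and cost\<close>

text \<open>Indices are shifted by one: \<open>t i\<close> is the time at which the walk \<open>w\<close> completes its first
  \<open>i\<close> segments. Only times \<open>\<ge> 0\<close> are relevant.\<close>

definition is_walk :: "complex list \<Rightarrow> (nat \<Rightarrow> real) \<Rightarrow> (real \<Rightarrow> complex) \<Rightarrow> bool" where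
  "is_walk vs t w \<longleftrightarrow>
     t 0 = 0 \<and>
     (\<forall>i. Suc i < length vs \<longrightarrow>
        t i < t (Suc i) \<and>
        continuous_on {t i..t (Suc i)} w \<and>
        w ` {t i..t (Suc i)} \<subseteq> closed_segment (vs ! i) (vs ! Suc i) \<and>
        w (t i) = vs ! i \<and> w (t (Suc i)) = vs ! Suc i) \<and>
     (\<forall>s\<ge>t (length vs - 1). w s = last vs)"

definition meet_at :: "(real \<Rightarrow> complex) \<Rightarrow> (real \<Rightarrow> complex) \<Rightarrow> real \<Rightarrow> bool" where
  "meet_at w1 w2 s \<longleftrightarrow> 0 \<le> s \<and> w1 s = w2 s"

definition rendezvous_time :: "(real \<Rightarrow> complex) \<Rightarrow> (real \<Rightarrow> complex) \<Rightarrow> real \<Rightarrow> bool" where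
  "rendezvous_time w1 w2 s \<longleftrightarrow> meet_at w1 w2 s \<and> (\<forall>s'<s. \<not> meet_at w1 w2 s')"

text \<open>If the rendezvous at time \<open>s\<close> happens while the agent is on a segment, this segment contributes
  its portion between its starting point and the meeting point.\<close>

definition trajectory_length ::
    "complex list \<Rightarrow> (nat \<Rightarrow> real) \<Rightarrow> (real \<Rightarrow> complex) \<Rightarrow> real \<Rightarrow> real" where
  "trajectory_length vs t w s =
     (\<Sum>i<length vs - 1.
        if t (Suc i) \<le> s then dist (vs ! i) (vs ! Suc i)
        else if t i < s then dist (vs ! i) (w s)
        else 0)"

text \<open>A set \<open>F\<close> of pairs of frames describes which equipment the two agents may have. It is left
  open whether their units of length are always equal (e.g. \<open>F = {(f, f)}\<close>) or private (\<open>F\<close>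
  contains all pairs with the same North): the units just must not be guaranteed to differ.\<close>

definition coherent_compasses :: "(frame \<times> frame) set \<Rightarrow> bool" where
  "coherent_compasses F \<longleftrightarrow>
     (\<forall>(f, g)\<in>F. is_frame f \<and> is_frame g \<and> north f = north g) \<and> (\<exists>f. (f, f) \<in> F)"

definition rendezvous_algorithm :: "(frame \<times> frame) set \<Rightarrow> algorithm \<Rightarrow> bool" where
  "rendezvous_algorithm F A \<longleftrightarrow>
     (\<forall>(f, g)\<in>F. \<forall>T x y.
        simple_polygon T \<and> x \<in> terrain T \<and> y \<in> terrain T \<and> x \<noteq> y \<longrightarrow>
        (\<exists>vs1 vs2. is_route A f T x vs1 \<and> is_route A g T y vs2 \<and>
           (\<forall>t1 w1 t2 w2. is_walk vs1 t1 w1 \<and> is_walk vs2 t2 w2 \<longrightarrow>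
              (\<exists>s. meet_at w1 w2 s))))"

text \<open>Worst case over everything that the adversary decides: frames, starting points at distance
  \<open>D\<close> and walks.\<close>

definition cost :: "(frame \<times> frame) set \<Rightarrow> algorithm \<Rightarrow> polygon \<Rightarrow> real \<Rightarrow> ereal" where
  "cost F A T D =
     Sup {ereal (trajectory_length vs1 t1 w1 s + trajectory_length vs2 t2 w2 s)
          | f g x y vs1 t1 w1 vs2 t2 w2 s.
            (f, g) \<in> F \<and>
            x \<in> terrain T \<and> y \<in> terrain T \<and> x \<noteq> y \<and> terrain_dist T x y = ereal D \<and>
            is_route A f T x vs1 \<and> is_route A g T y vs2 \<and>
            is_walk vs1 t1 w1 \<and> is_walk vs2 t2 w2 \<and>
            rendezvous_time w1 w2 s}"

end

theory Submission
  imports Defs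
begin

text \<open>The polygon is a square of side \<open>2 r\<close>. If \<open>D\<close> is at least \<open>r / 2\<close>, the agents have to cover
  the distance between them. Otherwise the adversary places two agents with equal equipment around
  the center. As long as neither has reached the boundary, they have perceived the same, so they
  choose the same steps, and the adversary makes them move in parallel: they cannot meet before
  one of them has travelled at least \<open>r / 2\<close> to the boundary.\<close>

section \<open>Walks with constant speed on each segment\<close>

text \<open>Clamping the time fraction of every segment to [0, 1] yields one formula for all times,
  so continuity requires no gluing of pieces and the length of the trajectory has the same
  coefficients.\<close>

definition linear_walk :: "complex list \<Rightarrow> (nat \<Rightarrow> real) \<Rightarrow> real \<Rightarrow> complex" where
  "linear_walk vs t s =
     hd vs + (\<Sum>i<length vs - 1.
       max 0 (min 1 ((s - t i) / (t (Suc i) - t i))) *\<^sub>R (vs ! Suc i - vs ! i))"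

lemma continuous_linear_walk: "continuous_on S (linear_walk vs t)"
  unfolding linear_walk_def divide_inverse by (intro continuous_intros)

context
  fixes vs :: "complex list" and t :: "nat \<Rightarrow> real"
  assumes vs: "vs \<noteq> []" and t: "strict_mono t"
begin

text \<open>Completed segments have coefficient 1 and later ones coefficient 0, so the sum
  telescopes to the vertex \<open>vs ! j\<close> plus a portion of segment \<open>j\<close>.\<close>

lemma linear_walk_between:
  assumes j: "Suc j < length vs" and s: "t j \<le> s" "s \<le> t (Suc j)"
  shows "linear_walk vs t s =
    vs ! j + ((s - t j) / (t (Suc j) - t j)) *\<^sub>R (vs ! Suc j - vs ! j)"
proof -
  let ?c = "\<lambda>i. max 0 (min 1 ((s - t i) / (t (Suc i) - t i)))"
  let ?g = "\<lambda>i. ?c i *\<^sub>R (vs ! Suc i - vs ! i)"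
  have pos: "t i < t (Suc i)" for i using t by (simp add: strict_mono_Suc_iff)
  have lo: "?c i = 1" if "i < j" for i
  proof -
    have "t (Suc i) \<le> s" using that s(1) strict_mono_less_eq[OF t, of "Suc i" j] by simp
    then show ?thesis using pos[of i] by (simp add: min_def)
  qed
  have hi: "?c i = 0" if "j < i" for i
  proof -
    have "s \<le> t i" using that s(2) strict_mono_less_eq[OF t, of "Suc j" i] by simp
    then show ?thesis using pos[of i] by (simp add: max_def min_def divide_le_0_iff zero_le_divide_iff)
  qed
  have mid: "?c j = (s - t j) / (t (Suc j) - t j)"
    using pos[of j] s by (simp add: min_def max_def)
  have split: "{..<length vs - 1} = {..<j} \<union> {j} \<union> {Suc j..<length vs - 1}" using j by auto
  have "sum ?g {..<length vs - 1} = sum ?g {..<j} + ?g j + sum ?g {Suc j..<length vs - 1}"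
    unfolding split by (subst sum.union_disjoint; auto)+
  also have "sum ?g {Suc j..<length vs - 1} = 0" using hi by (intro sum.neutral) auto
  also have "sum ?g {..<j} = (\<Sum>i<j. vs ! Suc i - vs ! i)" using lo by (intro sum.cong) auto
  also have "\<dots> = vs ! j - vs ! 0" by (rule sum_lessThan_telescope)
  finally show ?thesis using mid vs by (simp add: linear_walk_def hd_conv_nth)
qed

lemma linear_walk_after:
  assumes s: "t (length vs - 1) \<le> s"
  shows "linear_walk vs t s = last vs"
proof -
  have pos: "t i < t (Suc i)" for i using t by (simp add: strict_mono_Suc_iff)
  have "max 0 (min 1 ((s - t i) / (t (Suc i) - t i))) = 1" if "i < length vs - 1" for i
  proof -
    have "t (Suc i) \<le> s"
      using that s strict_mono_less_eq[OF t, of "Suc i" "length vs - 1"] by simp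
    then show ?thesis using pos[of i] by (simp add: min_def)
  qed
  then have "linear_walk vs t s = hd vs + (\<Sum>i<length vs - 1. vs ! Suc i - vs ! i)"
    by (simp add: linear_walk_def)
  then show ?thesis using vs by (simp add: sum_lessThan_telescope hd_conv_nth last_conv_nth)
qed

lemma linear_walk_vertex:
  assumes "j < length vs"
  shows "linear_walk vs t (t j) = vs ! j"
proof (cases "Suc j < length vs")
  case True
  then show ?thesis
    using linear_walk_between[of j "t j"] strict_mono_less_eq[OF t, of j "Suc j"] by simp
next
  case False
  then have "j = length vs - 1" using assms by simp
  then show ?thesis using linear_walk_after[of "t j"] vs by (simp add: last_conv_nth)
qed

lemma dist_linear_walk:
  assumes "Suc i < length vs" "t i < s" "s \<le> t (Suc i)"
  shows "dist (vs ! i) (linear_walk vs t s) =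
    (s - t i) / (t (Suc i) - t i) * dist (vs ! i) (vs ! Suc i)"
  using assms by (simp add: linear_walk_between dist_norm norm_minus_commute)

text \<open>From here on, the adversary describes a walk by its times \<open>t\<close>
  alone.\<close>

lemma is_walk_linear_walk:
  assumes "t 0 = 0"
  shows "is_walk vs t (linear_walk vs t)"
proof -
  have pos: "t i < t (Suc i)" for i using t by (simp add: strict_mono_Suc_iff)
  have "linear_walk vs t ` {t i..t (Suc i)} \<subseteq> closed_segment (vs ! i) (vs ! Suc i)"
    if "Suc i < length vs" for i
  proof
    fix z assume "z \<in> linear_walk vs t ` {t i..t (Suc i)}"
    then obtain s where s: "t i \<le> s" "s \<le> t (Suc i)" and z: "z = linear_walk vs t s" by auto
    define u where "u = (s - t i) / (t (Suc i) - t i)"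
    have "0 \<le> u" "u \<le> 1" using s pos[of i] by (auto simp: u_def)
    moreover have "z = (1 - u) *\<^sub>R (vs ! i) + u *\<^sub>R (vs ! Suc i)"
      unfolding z linear_walk_between[OF that s] u_def[symmetric] by (simp add: algebra_simps)
    ultimately show "z \<in> closed_segment (vs ! i) (vs ! Suc i)"
      unfolding closed_segment_def by blast
  qed
  then show ?thesis
    unfolding is_walk_def
    using assms pos continuous_linear_walk linear_walk_after
    by (intro conjI allI impI linear_walk_vertex) simp_all
qed

text \<open>The three cases of \<open>trajectory_length\<close> are the coefficients 1, strictly
  between 0 and 1, and 0. Estimates can now be made summand by summand.\<close>

lemma trajectory_length_linear_walk:
  "trajectory_length vs t (linear_walk vs t) s =
     (\<Sum>i<length vs - 1.
       max 0 (min 1 ((s - t i) / (t (Suc i) - t i))) * dist (vs ! i) (vs ! Suc i))"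
  unfolding trajectory_length_def
proof (intro sum.cong refl)
  fix i assume i: "i \<in> {..<length vs - 1}"
  have pos: "t i < t (Suc i)" using t by (simp add: strict_mono_Suc_iff)
  show "(if t (Suc i) \<le> s then dist (vs ! i) (vs ! Suc i)
         else if t i < s then dist (vs ! i) (linear_walk vs t s) else 0) =
        max 0 (min 1 ((s - t i) / (t (Suc i) - t i))) * dist (vs ! i) (vs ! Suc i)"
    using pos i dist_linear_walk[of i s]
    by (auto simp: min_def max_def divide_le_0_iff zero_le_divide_iff)
qed

lemma trajectory_length_linear_walk_mono:
  assumes "s \<le> s'"
  shows "trajectory_length vs t (linear_walk vs t) s \<le> trajectory_length vs t (linear_walk vs t) s'"
  unfolding trajectory_length_linear_walk
proof (intro sum_mono mult_right_mono)
  fix i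
  have "t i < t (Suc i)" using t by (simp add: strict_mono_Suc_iff)
  then have "(s - t i) / (t (Suc i) - t i) \<le> (s' - t i) / (t (Suc i) - t i)"
    using assms by (simp add: divide_right_mono)
  then show "max 0 (min 1 ((s - t i) / (t (Suc i) - t i)))
      \<le> max 0 (min 1 ((s' - t i) / (t (Suc i) - t i)))"
    by auto
qed simp

text \<open>Triangle inequality: the norms of the summands of the displacement are the summands of
  the length.\<close>

lemma dist_le_trajectory_length_linear_walk:
  "dist (hd vs) (linear_walk vs t s) \<le> trajectory_length vs t (linear_walk vs t) s"
proof -
  have "dist (hd vs) (linear_walk vs t s) = norm (\<Sum>i<length vs - 1.
       max 0 (min 1 ((s - t i) / (t (Suc i) - t i))) *\<^sub>R (vs ! Suc i - vs ! i))"
    by (simp add: linear_walk_def dist_norm)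
  also have "\<dots> \<le> trajectory_length vs t (linear_walk vs t) s"
    unfolding trajectory_length_linear_walk
    by (rule sum_norm_le) (simp add: dist_norm norm_minus_commute)
  finally show ?thesis .
qed

end

section \<open>First meetings and lengths of trajectories\<close>

text \<open>A rendezvous algorithm promises only some meeting time, whereas the cost refers to the
  first one. For continuous walks the set of meeting times is closed and bounded below, so it
  contains its infimum.\<close>

lemma rendezvous_time_exists:
  assumes "continuous_on UNIV w1" "continuous_on UNIV w2" "meet_at w1 w2 s0"
  shows "\<exists>s. rendezvous_time w1 w2 s"
proof -
  let ?M = "{s. 0 \<le> s} \<inter> {s. w1 s = w2 s}"
  have "closed ?M"
    using assms by (intro closed_Int closed_Collect_eq closed_Collect_le) (auto intro: continuous_intros)
  moreover have "s0 \<in> ?M" using assms by (simp add: meet_at_def)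
  moreover have bdd: "bdd_below ?M" by (intro bdd_belowI[of _ 0]) auto
  ultimately have "Inf ?M \<in> ?M" by (intro closed_contains_Inf) auto
  moreover have "\<not> meet_at w1 w2 s" if "s < Inf ?M" for s
    using cInf_lower[OF _ bdd, of s] that by (auto simp: meet_at_def)
  ultimately show ?thesis unfolding rendezvous_time_def meet_at_def by blast
qed

lemma rendezvous_time_commute: "rendezvous_time w1 w2 s \<longleftrightarrow> rendezvous_time w2 w1 s"
  by (auto simp: rendezvous_time_def meet_at_def)

lemma dist_le_trajectory_lengths:
  assumes "vs1 \<noteq> []" "vs2 \<noteq> []" "strict_mono t1" "strict_mono t2"
    and "linear_walk vs1 t1 s = linear_walk vs2 t2 s"
  shows "dist (hd vs1) (hd vs2) \<le> trajectory_length vs1 t1 (linear_walk vs1 t1) s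
           + trajectory_length vs2 t2 (linear_walk vs2 t2) s"
  using dist_le_trajectory_length_linear_walk[OF assms(1,3), of s]
    dist_le_trajectory_length_linear_walk[OF assms(2,4), of s]
    dist_triangle2[of "hd vs1" "hd vs2" "linear_walk vs1 t1 s"] assms(5)
  by simp

lemma trajectory_length_nonneg: "0 \<le> trajectory_length vs t w s"
  unfolding trajectory_length_def by (intro sum_nonneg) auto

section \<open>Steps that start in the interior\<close>

lemma closed_boundary: "closed (boundary T)"
  unfolding boundary_def edges_def by (intro closed_UN) (auto simp: edge_def)

text \<open>This makes all interior points indistinguishable to an agent.\<close>

lemma slopes_empty: "p \<notin> boundary T \<Longrightarrow> slopes f T p = {}"
  by (auto simp: slopes_def boundary_def)

text \<open>A segment that avoids \<open>B\<close> stays in one component of the complement, and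
  \<open>inside B\<close> is a union of such components.\<close>

lemma inside_shift:
  fixes p v :: "'a::real_normed_vector"
  assumes p: "p \<in> inside B" and free: "\<And>s. 0 \<le> s \<Longrightarrow> s \<le> 1 \<Longrightarrow> p + s *\<^sub>R v \<notin> B"
  shows "p + v \<in> inside B"
proof (rule inside_same_component[OF _ p])
  have "closed_segment p (p + v) \<subseteq> - B"
  proof
    fix z assume "z \<in> closed_segment p (p + v)"
    then obtain u where "0 \<le> u" "u \<le> 1" "z = (1 - u) *\<^sub>R p + u *\<^sub>R (p + v)"
      unfolding closed_segment_def by blast
    then show "z \<in> - B" using free[of u] by (simp add: algebra_simps)
  qed
  then show "connected_component (- B) p (p + v)"
    by (meson connected_segment(1) connected_component_def ends_in_segment)
qed

text \<open>The displacement that an action would cause in an unbounded plane.\<close>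

definition displacement :: "frame \<Rightarrow> action \<Rightarrow> complex" where
  "displacement f act =
     (case act of Move \<theta> r \<Rightarrow> max 0 (r * unit_length f) *\<^sub>R heading f \<theta> | Follow \<theta> ro \<Rightarrow> 0)"

text \<open>No edge passes through an interior point, so \<open>Follow\<close> is void there. A
  \<open>Move\<close> is either completed or cut off at the first boundary point, after a positive
  fraction \<open>k\<close> of the displacement.\<close>

lemma step_from_inside:
  assumes p: "p \<in> inside (boundary T)"
  shows "(step f T p act \<in> inside (boundary T) \<and> step f T p act = p + displacement f act) \<or>
    (\<exists>k. 0 < k \<and> k \<le> 1 \<and> step f T p act \<in> boundary T \<and>
       step f T p act = p + k *\<^sub>R displacement f act)"
proof (cases act)
  case (Follow \<theta> ro)
  have "p \<notin> boundary T" using p inside_no_overlap by blast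
  then have none: "\<nexists>b. follow_target T p d b" for d
    by (auto simp: follow_target_def boundary_def closed_segment_commute)
  have "step f T p act = p" by (simp add: Follow none)
  then show ?thesis using p Follow by (simp add: displacement_def)
next
  case (Move \<theta> r)
  define d where "d = heading f \<theta>"
  define l where "l = r * unit_length f"
  define H where "H = {s. 0 < s \<and> s \<le> l \<and> p + s *\<^sub>R d \<in> boundary T}"
  have disp: "displacement f act = max 0 l *\<^sub>R d" by (simp add: displacement_def Move d_def l_def)
  have pB: "p \<notin> boundary T" using p inside_no_overlap by blast
  show ?thesis
  proof (cases "0 < l")
    case False
    then have "step f T p act = p" using Move by (simp add: move_end_def l_def)
    then show ?thesis using p False disp by simp
  next
    case l: True
    \<comment> \<open>As the interior is open, the guard in \<open>move_end\<close> holds in every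
      direction.\<close>
    have "open ((\<lambda>s. p + s *\<^sub>R d) -` inside (boundary T))"
      using open_inside[OF closed_boundary]
      by (rule open_vimage) (intro continuous_intros)
    then obtain e where e: "e > 0" "ball 0 e \<subseteq> (\<lambda>s. p + s *\<^sub>R d) -` inside (boundary T)"
      using p unfolding open_contains_ball by force
    have "\<exists>e>0. \<forall>s\<in>{0<..<e}. p + s *\<^sub>R d \<in> inside (boundary T)"
      using e by (intro exI[of _ e]) (auto simp: subset_iff)
    then have "move_end T p d l = p + (if H = {} then l else Inf H) *\<^sub>R d"
      using l unfolding move_end_def Let_def H_def[symmetric] by simp
    then have step: "step f T p act = p + (if H = {} then l else Inf H) *\<^sub>R d"
      by (simp add: Move d_def l_def)
    show ?thesis
    proof (cases "H = {}")
      case True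
      have "p + l *\<^sub>R d \<in> inside (boundary T)"
      proof (rule inside_shift[OF p])
        fix s :: real assume s: "0 \<le> s" "s \<le> 1"
        show "p + s *\<^sub>R l *\<^sub>R d \<notin> boundary T"
        proof (cases "s = 0")
          case False
          then have "0 < s * l" "s * l \<le> l" using s l by auto
          then show ?thesis using True by (auto simp: H_def)
        qed (use pB in simp)
      qed
      then show ?thesis using step True l disp by simp
    next
      case False
      \<comment> \<open>Since \<open>p\<close> is not on the boundary, the bound
        \<open>0 < s\<close> may be weakened to \<open>0 \<le> s\<close>. This shows that
        \<open>H\<close> is closed, so \<open>Inf H\<close> is attained.\<close>
      have "H = {0..l} \<inter> (\<lambda>s. p + s *\<^sub>R d) -` boundary T"
        using pB by (auto simp: H_def less_le)
      also have "closed \<dots>"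
        by (intro closed_Int closed_vimage closed_boundary continuous_intros)
      finally have "closed H" .
      moreover have "bdd_below H" by (intro bdd_belowI[of _ 0]) (auto simp: H_def)
      ultimately have "Inf H \<in> H" using False by (intro closed_contains_Inf)
      then have "0 < Inf H / l" "Inf H / l \<le> 1" "p + Inf H *\<^sub>R d \<in> boundary T"
        using l by (auto simp: H_def)
      then show ?thesis using step False l disp by (intro disjI2 exI[of _ "Inf H / l"]) simp
    qed
  qed
qed

text \<open>The agent that hits the boundary first does so after a displacement which the other agent
  repeats on the way to the end of its own step.\<close>

lemma steps_from_inside:
  assumes p: "p \<in> inside (boundary T)" and q: "q \<in> inside (boundary T)"
    and p': "p' = step f T p act" and q': "q' = step f T q act"
  obtains "p' \<in> inside (boundary T)" "q' \<in> inside (boundary T)" "q' - p' = q - p"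
  | k where "p' \<in> boundary T" "1 \<le> k" "q' - q = k *\<^sub>R (p' - p)"
  | k where "q' \<in> boundary T" "1 \<le> k" "p' - p = k *\<^sub>R (q' - q)"
proof -
  let ?v = "displacement f act"
  consider (free) "p' \<in> inside (boundary T)" "p' = p + ?v"
    | (hit) k where "0 < k" "k \<le> 1" "p' \<in> boundary T" "p' = p + k *\<^sub>R ?v"
    using step_from_inside[OF p] p' by metis
  note P = this
  consider (free) "q' \<in> inside (boundary T)" "q' = q + ?v"
    | (hit) k where "0 < k" "k \<le> 1" "q' \<in> boundary T" "q' = q + k *\<^sub>R ?v"
    using step_from_inside[OF q] q' by metis
  note Q = this
  show thesis
  proof (cases rule: P)
    case free_p: free
    show thesis
    proof (cases rule: Q)
      case free
      then show thesis using free_p by (intro that(1)) auto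
    next
      case (hit k)
      \<comment> \<open>The step from \<open>q\<close> stops after the fraction \<open>k\<close> of
        the displacement that the step from \<open>p\<close> completes, hence the ratio
        \<open>1 / k\<close>.\<close>
      then show thesis using free_p by (intro that(3)[of "1 / k"]) auto
    qed
  next
    case hit_p: (hit k)
    show thesis
    proof (cases rule: Q)
      case free
      then show thesis using hit_p by (intro that(2)[of "1 / k"]) auto
    next
      case (hit m)
      show thesis
      proof (cases "k \<le> m")
        case True
        then show thesis using hit hit_p by (intro that(2)[of "m / k"]) auto
      next
        case False
        then show thesis using hit hit_p by (intro that(3)[of "k / m"]) auto
      qed
    qed
  qed
qed

section \<open>Routes that are translates of each other\<close>

text \<open>Besides the constant offset, the vertices have to be interior: this is what makes the
  perceptions of the agents agree.\<close>

definition parallel_until :: "polygon \<Rightarrow> complex \<Rightarrow> complex list \<Rightarrow> complex list \<Rightarrow> nat \<Rightarrow> bool" where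
  "parallel_until T v vs1 vs2 n \<longleftrightarrow> n < length vs1 \<and> n < length vs2 \<and>
     (\<forall>j\<le>n. vs1 ! j \<in> inside (boundary T) \<and> vs2 ! j \<in> inside (boundary T) \<and> vs2 ! j = vs1 ! j + v)"

text \<open>Translation preserves the lengths of steps, and no slopes are perceived at interior
  points. A deterministic algorithm therefore gives both agents the same answer.\<close>

lemma history_parallel:
  assumes par: "parallel_until T v vs1 vs2 n"
  shows "history f T (take (Suc n) vs1) = history f T (take (Suc n) vs2)"
proof -
  have len: "length (take (Suc n) vs1) = Suc n" "length (take (Suc n) vs2) = Suc n"
    using par by (auto simp: parallel_until_def)
  have slopes: "slopes f T (vs1 ! i) = slopes f T (vs2 ! i)" if "i \<le> n" for i
  proof -
    have "vs1 ! i \<notin> boundary T" "vs2 ! i \<notin> boundary T"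
      using par that inside_no_overlap[of "boundary T"] unfolding parallel_until_def by blast+
    then show ?thesis by (simp add: slopes_empty)
  qed
  have dist: "dist (vs1 ! (i - 1)) (vs1 ! i) = dist (vs2 ! (i - 1)) (vs2 ! i)" if "i \<le> n" for i
  proof -
    have "vs2 ! i = vs1 ! i + v" "vs2 ! (i - 1) = vs1 ! (i - 1) + v"
      using par that by (auto simp: parallel_until_def)
    then show ?thesis by simp
  qed
  show ?thesis
    unfolding history_def len using slopes dist by (auto intro!: map_cong)
qed

text \<open>Turns equal answers of the algorithm into equal continuations of two routes.\<close>

lemma is_route_next:
  assumes r: "is_route A f T x vs" and n: "n < length vs"
  shows "case A (history f T (take (Suc n) vs)) of
      None \<Rightarrow> length vs = Suc n
    | Some act \<Rightarrow> Suc n < length vs \<and> vs ! Suc n = step f T (vs ! n) act"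
proof (cases "Suc n < length vs")
  case True
  then show ?thesis using r by (auto simp: is_route_def)
next
  case False
  then have "length vs = Suc n" using n by simp
  then show ?thesis using r by (simp add: is_route_def)
qed

text \<open>After equal histories both routes end or both agents take the same action, and
  \<open>steps_from_inside\<close> lists the outcomes of the latter.\<close>

lemma parallel_until_step:
  assumes r: "is_route A f T x vs1" "is_route A f T y vs2"
    and par: "parallel_until T v vs1 vs2 n"
  obtains (finish) "length vs1 = Suc n" "length vs2 = Suc n"
  | (continue) "parallel_until T v vs1 vs2 (Suc n)"
  | (first) k where "Suc n < length vs1" "Suc n < length vs2" "vs1 ! Suc n \<in> boundary T" "1 \<le> k"
      "vs2 ! Suc n - vs2 ! n = k *\<^sub>R (vs1 ! Suc n - vs1 ! n)"
  | (second) k where "Suc n < length vs1" "Suc n < length vs2" "vs2 ! Suc n \<in> boundary T" "1 \<le> k"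
      "vs1 ! Suc n - vs1 ! n = k *\<^sub>R (vs2 ! Suc n - vs2 ! n)"
proof -
  have n: "n < length vs1" "n < length vs2"
    and ins: "vs1 ! n \<in> inside (boundary T)" "vs2 ! n \<in> inside (boundary T)"
    and diff: "vs2 ! n = vs1 ! n + v"
    using par by (auto simp: parallel_until_def)
  note next1 = is_route_next[OF r(1) n(1)] and next2 = is_route_next[OF r(2) n(2)]
  show thesis
  proof (cases "A (history f T (take (Suc n) vs1))")
    case None
    then show thesis using next1 next2 history_parallel[OF par, of f] by (intro finish) auto
  next
    case (Some act)
    then have len: "Suc n < length vs1" "Suc n < length vs2"
      and s: "vs1 ! Suc n = step f T (vs1 ! n) act" "vs2 ! Suc n = step f T (vs2 ! n) act"
      using next1 next2 history_parallel[OF par, of f] by auto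
    show thesis
    proof (rule steps_from_inside[OF ins s])
      assume "vs1 ! Suc n \<in> inside (boundary T)" "vs2 ! Suc n \<in> inside (boundary T)"
        "vs2 ! Suc n - vs1 ! Suc n = vs2 ! n - vs1 ! n"
      then have "parallel_until T v vs1 vs2 (Suc n)"
        using par len diff by (auto simp: parallel_until_def le_Suc_eq algebra_simps)
      then show thesis by (rule continue)
    qed (use len first second in blast)+
  qed
qed

lemma parallel_until_0:
  assumes "is_route A f T x vs1" "is_route A f T y vs2"
    and "x \<in> inside (boundary T)" "y \<in> inside (boundary T)"
  shows "parallel_until T (y - x) vs1 vs2 0"
  using assms by (auto simp: parallel_until_def is_route_def hd_conv_nth)

text \<open>Routes are finite, so the parallel phase that holds at index 0 has to break off.\<close>

lemma last_parallel:
  assumes "is_route A f T x vs1" "is_route A f T y vs2"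
    and "x \<in> inside (boundary T)" "y \<in> inside (boundary T)"
  obtains n where "parallel_until T (y - x) vs1 vs2 n" "\<not> parallel_until T (y - x) vs1 vs2 (Suc n)"
proof -
  have "\<not> parallel_until T (y - x) vs1 vs2 (length vs1)" by (simp add: parallel_until_def)
  then show thesis using parallel_until_0[OF assms] that by (metis dec_induct le0)
qed

text \<open>With one unit of time per step, both agents are always at the same fraction of
  translated segments. The times after \<open>n\<close> are left open, so that one agent can be
  slowed down later.\<close>

lemma linear_walks_parallel:
  assumes par: "parallel_until T v vs1 vs2 n"
    and t1: "strict_mono t1" "\<And>j. j \<le> n \<Longrightarrow> t1 j = real j"
    and t2: "strict_mono t2" "\<And>j. j \<le> n \<Longrightarrow> t2 j = real j"
    and s: "0 \<le> s" "s \<le> real n"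
  shows "linear_walk vs2 t2 s = linear_walk vs1 t1 s + v"
proof -
  have n: "n < length vs1" "n < length vs2" "vs1 \<noteq> []" "vs2 \<noteq> []"
    and d: "\<And>j. j \<le> n \<Longrightarrow> vs2 ! j = vs1 ! j + v"
    using par by (auto simp: parallel_until_def)
  show ?thesis
  \<comment> \<open>Time \<open>real n\<close> is treated apart because the routes may have no
    segment \<open>n\<close>.\<close>
  proof (cases "s = real n")
    case True
    then show ?thesis
      using linear_walk_vertex[OF n(3) t1(1) n(1)] linear_walk_vertex[OF n(4) t2(1) n(2)]
        t1(2)[of n] t2(2)[of n] d[of n] by simp
  next
    case False
    define j where "j = nat \<lfloor>s\<rfloor>"
    have j: "real j \<le> s" "s \<le> real (Suc j)" unfolding j_def using s by linarith+
    have jn: "Suc j \<le> n" using False s by (simp add: j_def) linarith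
    have "linear_walk vs1 t1 s = vs1 ! j + (s - real j) *\<^sub>R (vs1 ! Suc j - vs1 ! j)"
      using linear_walk_between[OF n(3) t1(1), of j s] j jn n t1(2)[of j] t1(2)[of "Suc j"] by simp
    moreover have "linear_walk vs2 t2 s = vs2 ! j + (s - real j) *\<^sub>R (vs2 ! Suc j - vs2 ! j)"
      using linear_walk_between[OF n(4) t2(1), of j s] j jn n t2(2)[of j] t2(2)[of "Suc j"] by simp
    moreover have "vs2 ! Suc j - vs2 ! j = vs1 ! Suc j - vs1 ! j"
      using d[of j] d[of "Suc j"] jn by simp
    ultimately show ?thesis using d[of j] jn by simp
  qed
qed

text \<open>In step \<open>n\<close> the second agent is given time \<open>k\<close>, so that it moves in parallel to the first one
  until that one hits the boundary.\<close>

lemma late_rendezvous: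
  assumes v: "v \<noteq> 0"
    and par: "parallel_until T v vs1 vs2 n"
    and len: "Suc n < length vs1" "Suc n < length vs2"
    and k: "1 \<le> k" "vs2 ! Suc n - vs2 ! n = k *\<^sub>R (vs1 ! Suc n - vs1 ! n)"
    and meets: "\<forall>t1 w1 t2 w2. is_walk vs1 t1 w1 \<and> is_walk vs2 t2 w2 \<longrightarrow> (\<exists>s. meet_at w1 w2 s)"
  obtains t1 w1 t2 w2 s where "is_walk vs1 t1 w1" "is_walk vs2 t2 w2" "rendezvous_time w1 w2 s"
    "dist (hd vs1) (vs1 ! Suc n) \<le> trajectory_length vs1 t1 w1 s"
proof -
  define t2 where "t2 j = (if j \<le> n then real j else real j - 1 + k)" for j
  define w1 where "w1 = linear_walk vs1 real"
  define w2 where "w2 = linear_walk vs2 t2"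
  have ne: "vs1 \<noteq> []" "vs2 \<noteq> []" using len by auto
  have t1: "strict_mono real" by (simp add: strict_mono_Suc_iff)
  have t2: "strict_mono t2" unfolding strict_mono_Suc_iff t2_def using k by auto
  have walks: "is_walk vs1 real w1" "is_walk vs2 t2 w2"
    unfolding w1_def w2_def by (intro is_walk_linear_walk ne t1 t2; simp add: t2_def)+
  obtain s where s: "rendezvous_time w1 w2 s"
    using rendezvous_time_exists[of w1 w2] meets walks continuous_linear_walk
    unfolding w1_def w2_def by blast
  \<comment> \<open>Before this time the agents are separated by exactly \<open>v\<close>, which is
    not 0.\<close>
  have "real (Suc n) \<le> s"
  proof (rule ccontr)
    assume "\<not> real (Suc n) \<le> s"
    then have sn: "s < real n + 1" by simp
    have s0: "0 \<le> s" and eq: "w1 s = w2 s" using s by (auto simp: rendezvous_time_def meet_at_def)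
    have "w2 s = w1 s + v"
    proof (cases "s \<le> real n")
      case True
      then show ?thesis unfolding w1_def w2_def
        by (intro linear_walks_parallel[OF par t1 _ t2 _ s0]) (auto simp: t2_def)
    next
      case False
      then have w1: "w1 s = vs1 ! n + (s - real n) *\<^sub>R (vs1 ! Suc n - vs1 ! n)"
        unfolding w1_def using linear_walk_between[OF ne(1) t1 len(1), of s] sn by simp
      \<comment> \<open>Step \<open>n\<close> of the second walk ends at time
        \<open>real n + k\<close>, so \<open>1 \<le> k\<close> ensures that \<open>s\<close> falls
        within it.\<close>
      have "w2 s = vs2 ! n + ((s - real n) / k) *\<^sub>R (vs2 ! Suc n - vs2 ! n)"
        unfolding w2_def using linear_walk_between[OF ne(2) t2 len(2), of s] sn False k(1)
        by (simp add: t2_def)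
      then have w2: "w2 s = vs2 ! n + (s - real n) *\<^sub>R (vs1 ! Suc n - vs1 ! n)"
        using k by simp
      show ?thesis using w1 w2 par by (simp add: parallel_until_def)
    qed
    then show False using eq v by simp
  qed
  then have "dist (hd vs1) (w1 (real (Suc n))) \<le> trajectory_length vs1 real w1 s"
    unfolding w1_def
    by (intro order_trans[OF dist_le_trajectory_length_linear_walk[OF ne(1) t1]
          trajectory_length_linear_walk_mono[OF ne(1) t1]])
  moreover have "w1 (real (Suc n)) = vs1 ! Suc n"
    unfolding w1_def by (rule linear_walk_vertex[OF ne(1) t1 len(1)])
  ultimately show thesis using that[OF walks s] by simp
qed

text \<open>Rules out that both routes end while still parallel: the agents would remain inert with
  offset \<open>v\<close>.\<close>

lemma no_meeting_if_parallel:
  assumes v: "v \<noteq> 0"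
    and par: "parallel_until T v vs1 vs2 n"
    and len: "length vs1 = Suc n" "length vs2 = Suc n"
  shows "\<exists>t1 w1 t2 w2. is_walk vs1 t1 w1 \<and> is_walk vs2 t2 w2 \<and> (\<nexists>s. meet_at w1 w2 s)"
proof -
  have ne: "vs1 \<noteq> []" "vs2 \<noteq> []" using len by auto
  have t: "strict_mono real" by (simp add: strict_mono_Suc_iff)
  have "\<not> meet_at (linear_walk vs1 real) (linear_walk vs2 real) s" for s
  proof
    assume m: "meet_at (linear_walk vs1 real) (linear_walk vs2 real) s"
    have "linear_walk vs2 real s = linear_walk vs1 real s + v"
    proof (cases "s \<le> real n")
      case True
      then show ?thesis
        using m by (intro linear_walks_parallel[OF par t _ t]) (auto simp: meet_at_def)
    next
      case False
      then have "linear_walk vs1 real s = vs1 ! n" "linear_walk vs2 real s = vs2 ! n"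
        using linear_walk_after[OF ne(1) t, of s] linear_walk_after[OF ne(2) t, of s] len ne
        by (auto simp: last_conv_nth)
      then show ?thesis using par by (simp add: parallel_until_def)
    qed
    then show False using m v by (simp add: meet_at_def)
  qed
  then show ?thesis using is_walk_linear_walk[OF ne(1) t] is_walk_linear_walk[OF ne(2) t]
    by (metis of_nat_0)
qed

section \<open>Lower bounds on the cost of an arbitrary algorithm\<close>

lemma cost_ge:
  assumes "(f, g) \<in> F" "x \<in> terrain T" "y \<in> terrain T" "x \<noteq> y" "terrain_dist T x y = ereal D"
    and "is_route A f T x vs1" "is_route A g T y vs2" "is_walk vs1 t1 w1" "is_walk vs2 t2 w2"
    and "rendezvous_time w1 w2 s"
    and "L \<le> trajectory_length vs1 t1 w1 s + trajectory_length vs2 t2 w2 s"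
  shows "ereal L \<le> cost F A T D"
proof -
  have "ereal (trajectory_length vs1 t1 w1 s + trajectory_length vs2 t2 w2 s) \<le> cost F A T D"
    unfolding cost_def using assms by (intro Sup_upper) blast
  then show ?thesis using assms(11) by (meson ereal_less_eq(3) order_trans)
qed

lemma rendezvous_algorithm_routes:
  assumes "rendezvous_algorithm F A" "(f, g) \<in> F" "simple_polygon T"
    and "x \<in> terrain T" "y \<in> terrain T" "x \<noteq> y"
  obtains vs1 vs2 where "is_route A f T x vs1" "is_route A g T y vs2"
    "\<forall>t1 w1 t2 w2. is_walk vs1 t1 w1 \<and> is_walk vs2 t2 w2 \<longrightarrow> (\<exists>s. meet_at w1 w2 s)"
  using assms unfolding rendezvous_algorithm_def by blast

text \<open>Both agents receive the frame \<open>f\<close>. At the last parallel index the routes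
  cannot end, so the next step leads one agent to the boundary, and \<open>late_rendezvous\<close>
  postpones the meeting until it has arrived there.\<close>

lemma cost_ge_boundary_distance:
  assumes alg: "rendezvous_algorithm F A" and f: "(f, f) \<in> F" and T: "simple_polygon T"
    and x: "x \<in> inside (boundary T)" and y: "y \<in> inside (boundary T)" and xy: "x \<noteq> y"
    and D: "terrain_dist T x y = ereal D"
    and L: "\<And>z. z \<in> boundary T \<Longrightarrow> L \<le> dist x z" "\<And>z. z \<in> boundary T \<Longrightarrow> L \<le> dist y z"
  shows "ereal L \<le> cost F A T D"
proof -
  have xy': "x \<in> terrain T" "y \<in> terrain T" using x y by (auto simp: terrain_def)
  obtain vs1 vs2 where r: "is_route A f T x vs1" "is_route A f T y vs2"
    and meets: "\<forall>t1 w1 t2 w2. is_walk vs1 t1 w1 \<and> is_walk vs2 t2 w2 \<longrightarrow> (\<exists>s. meet_at w1 w2 s)"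
    using rendezvous_algorithm_routes[OF alg f T xy' xy] .
  have hd: "hd vs1 = x" "hd vs2 = y" using r by (auto simp: is_route_def)
  note cost = cost_ge[OF f xy' xy D r]
  obtain n where n: "parallel_until T (y - x) vs1 vs2 n" "\<not> parallel_until T (y - x) vs1 vs2 (Suc n)"
    using last_parallel[OF r x y] .
  from r n(1) show ?thesis
  proof (cases rule: parallel_until_step)
    case finish
    then show ?thesis using no_meeting_if_parallel[OF _ n(1)] meets xy by (metis right_minus_eq)
  next
    case continue
    then show ?thesis using n(2) by contradiction
  next
    case (first k)
    have "y - x \<noteq> 0" using xy by simp
    then obtain t1 w1 t2 w2 s where w: "is_walk vs1 t1 w1" "is_walk vs2 t2 w2"
      "rendezvous_time w1 w2 s" and "dist (hd vs1) (vs1 ! Suc n) \<le> trajectory_length vs1 t1 w1 s"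
      using late_rendezvous[OF _ n(1) first(1,2,4,5) meets] by blast
    then show ?thesis
      using L(1)[OF first(3)] trajectory_length_nonneg[of vs2 t2 w2 s] hd by (intro cost[OF w]) simp
  next
    case (second k)
    have v: "x - y \<noteq> 0" using xy by simp
    \<comment> \<open>The second agent hits first, so the roles are exchanged and the offset changes
      its sign.\<close>
    have par: "parallel_until T (x - y) vs2 vs1 n"
      using n(1) by (auto simp: parallel_until_def algebra_simps)
    have "\<forall>t1 w1 t2 w2. is_walk vs2 t1 w1 \<and> is_walk vs1 t2 w2 \<longrightarrow> (\<exists>s. meet_at w1 w2 s)"
      using meets unfolding meet_at_def by metis
    from late_rendezvous[OF v par second(2,1,4,5) this]
    obtain t1 w1 t2 w2 s where "is_walk vs2 t2 w2" "is_walk vs1 t1 w1" "rendezvous_time w2 w1 s"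
      and far: "dist (hd vs2) (vs2 ! Suc n) \<le> trajectory_length vs2 t2 w2 s" by blast
    then have w: "is_walk vs1 t1 w1" "is_walk vs2 t2 w2" "rendezvous_time w1 w2 s"
      by (simp_all add: rendezvous_time_commute)
    show ?thesis
      using far L(2)[OF second(3)] trajectory_length_nonneg[of vs1 t1 w1 s] hd
      by (intro cost[OF w]) simp
  qed
qed

text \<open>The two trajectories up to the meeting connect the starting points. This bound serves
  for large \<open>D\<close>.\<close>

lemma cost_ge_dist:
  assumes alg: "rendezvous_algorithm F A" and f: "(f, f) \<in> F" and T: "simple_polygon T"
    and xy: "x \<in> terrain T" "y \<in> terrain T" "x \<noteq> y"
    and D: "terrain_dist T x y = ereal D"
  shows "ereal (dist x y) \<le> cost F A T D"
proof -
  obtain vs1 vs2 where r: "is_route A f T x vs1" "is_route A f T y vs2"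
    and meets: "\<forall>t1 w1 t2 w2. is_walk vs1 t1 w1 \<and> is_walk vs2 t2 w2 \<longrightarrow> (\<exists>s. meet_at w1 w2 s)"
    using rendezvous_algorithm_routes[OF alg f T xy] .
  have ne: "vs1 \<noteq> []" "vs2 \<noteq> []" and hd: "hd vs1 = x" "hd vs2 = y"
    using r by (auto simp: is_route_def)
  have t: "strict_mono real" by (simp add: strict_mono_Suc_iff)
  note walks = is_walk_linear_walk[OF ne(1) t of_nat_0] is_walk_linear_walk[OF ne(2) t of_nat_0]
  obtain s0 where "meet_at (linear_walk vs1 real) (linear_walk vs2 real) s0"
    using meets walks by blast
  then obtain s where s: "rendezvous_time (linear_walk vs1 real) (linear_walk vs2 real) s"
    using rendezvous_time_exists continuous_linear_walk by blast
  then have "linear_walk vs1 real s = linear_walk vs2 real s"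
    by (simp add: rendezvous_time_def meet_at_def)
  then show ?thesis
    using cost_ge[OF f xy D r walks s] dist_le_trajectory_lengths[OF ne t t] hd by simp
qed

section \<open>Distances in convex terrains\<close>

text \<open>The partition consisting of 0 and 1 alone already contributes this value to the
  supremum.\<close>

lemma path_length_ge_dist: "ereal (dist (pathstart g) (pathfinish g)) \<le> path_length g"
proof -
  have "ereal (\<Sum>i<length [0, 1 :: real] - 1. dist (g ([0, 1] ! i)) (g ([0, 1] ! Suc i)))
      \<le> path_length g"
    unfolding path_length_def by (rule SUP_upper) auto
  then show ?thesis by (simp add: pathstart_def pathfinish_def)
qed

text \<open>On a straight line every partition sum telescopes to the parameter range that it covers
  times \<open>dist x y\<close>.\<close>

lemma path_length_linepath: "path_length (linepath x y) \<le> ereal (dist x y)"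
  unfolding path_length_def
proof (rule SUP_least)
  fix ts :: "real list" assume "ts \<in> {ts. sorted ts \<and> set ts \<subseteq> {0..1}}"
  then have ts: "sorted ts" "set ts \<subseteq> {0..1}" by auto
  have "(\<Sum>i<length ts - 1. dist (linepath x y (ts ! i)) (linepath x y (ts ! Suc i)))
      = (\<Sum>i<length ts - 1. (ts ! Suc i - ts ! i) * dist x y)"
  proof (intro sum.cong refl)
    fix i assume "i \<in> {..<length ts - 1}"
    then have "ts ! i \<le> ts ! Suc i" using ts(1) by (simp add: sorted_iff_nth_mono)
    moreover have "linepath x y (ts ! i) - linepath x y (ts ! Suc i)
        = (ts ! Suc i - ts ! i) *\<^sub>R (x - y)"
      by (simp add: linepath_def algebra_simps)
    ultimately show "dist (linepath x y (ts ! i)) (linepath x y (ts ! Suc i))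
        = (ts ! Suc i - ts ! i) * dist x y"
      by (simp add: dist_norm)
  qed
  also have "\<dots> = (ts ! (length ts - 1) - ts ! 0) * dist x y"
    by (simp add: sum_distrib_right[symmetric] sum_lessThan_telescope)
  also have "\<dots> \<le> 1 * dist x y"
  proof (intro mult_right_mono)
    show "ts ! (length ts - 1) - ts ! 0 \<le> 1"
    \<comment> \<open>For the empty list both indices are 0, so the difference vanishes whatever
      \<open>ts ! 0\<close> is.\<close>
    proof (cases "ts = []")
      case False
      then have "ts ! (length ts - 1) \<in> {0..1}" "ts ! 0 \<in> {0..1}"
        using ts(2) by (simp_all add: subset_iff)
      then show ?thesis by simp
    qed simp
  qed simp
  finally show "ereal (\<Sum>i<length ts - 1. dist (linepath x y (ts ! i)) (linepath x y (ts ! Suc i)))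
      \<le> ereal (dist x y)" by simp
qed

text \<open>The straight segment stays in a convex terrain, and no path is shorter.\<close>

lemma terrain_dist_convex:
  assumes "convex (terrain T)" "x \<in> terrain T" "y \<in> terrain T"
  shows "terrain_dist T x y = ereal (dist x y)"
proof (rule antisym)
  have "path_image (linepath x y) \<subseteq> terrain T"
    using assms by (simp add: convex_contains_segment)
  then have "terrain_dist T x y \<le> path_length (linepath x y)"
    unfolding terrain_dist_def by (intro INF_lower) auto
  then show "terrain_dist T x y \<le> ereal (dist x y)"
    using path_length_linepath order_trans by blast
  show "ereal (dist x y) \<le> terrain_dist T x y"
    unfolding terrain_dist_def using path_length_ge_dist by (intro INF_greatest) blast
qed

section \<open>Geometry of the square\<close>

text \<open>Up to sign, the imaginary part is the cross product of \<open>b - a\<close> and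
  \<open>c - b\<close>. For concrete vertices this reduces collinearity to arithmetic.\<close>

lemma collinear_imp_Im_eq_0:
  assumes "collinear {a, b, c}"
  shows "Im ((b - a) * cnj (c - b)) = 0"
proof -
  obtain u k m where "b - a = k *\<^sub>R u" "c - b = m *\<^sub>R u"
    using assms unfolding collinear_def by blast
  then show ?thesis by simp
qed

definition square :: "real \<Rightarrow> polygon" where
  "square r = [Complex (- r) (- r), Complex r (- r), Complex r r, Complex (- r) r]"

lemma edges_square:
  "edges (square r) =
    {(Complex (- r) (- r), Complex r (- r)), (Complex r (- r), Complex r r),
     (Complex r r, Complex (- r) r), (Complex (- r) r, Complex (- r) (- r))}"
proof -
  have "{..<length (square r)} = {0, 1, 2, 3}" by (auto simp: square_def)
  then show ?thesis by (simp add: edges_def edge_def square_def)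
qed

context
  fixes r :: real
  assumes r: "0 < r"
begin

lemma simple_polygon_square: "simple_polygon (square r)"
proof -
  have "closed_segment a b \<inter> closed_segment c d \<subseteq> {a, b} \<inter> {c, d}"
    if "(a, b) \<in> edges (square r)" "(c, d) \<in> edges (square r)" "(a, b) \<noteq> (c, d)" for a b c d
    using that r unfolding edges_square
    by (auto simp: closed_segment_same_Re closed_segment_same_Im closed_segment_eq_real_ivl
        complex_eq_iff)
  moreover have "\<not> collinear {a, b, c}"
    if "(a, b) \<in> edges (square r)" "(b, c) \<in> edges (square r)" for a b c
  proof
    assume "collinear {a, b, c}"
    then have "Im ((b - a) * cnj (c - b)) = 0" by (rule collinear_imp_Im_eq_0)
    then show False using that r unfolding edges_square by auto
  qed
  moreover have "3 \<le> length (square r)" "distinct (square r)" using r by (auto simp: square_def)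
  ultimately show ?thesis unfolding simple_polygon_def by blast
qed

lemma perimeter_square: "perimeter (square r) = 8 * r"
  using r by (simp add: perimeter_def edges_square dist_norm cmod_def real_sqrt_mult)

text \<open>As the frontier of a bounded convex set, the boundary has the interior of that set as
  its inside.\<close>

lemma boundary_square: "boundary (square r) = frontier (cbox (Complex (- r) (- r)) (Complex r r))"
  using r
  by (auto simp: boundary_def edges_square frontier_cbox in_cbox_complex_iff in_box_complex_iff
      closed_segment_same_Re closed_segment_same_Im closed_segment_eq_real_ivl)

lemma inside_boundary_square: "inside (boundary (square r)) = box (Complex (- r) (- r)) (Complex r r)"
  by (simp add: boundary_square inside_frontier_eq_interior)

lemma terrain_square: "terrain (square r) = cbox (Complex (- r) (- r)) (Complex r r)"
  using box_subset_cbox[of "Complex (- r) (- r)" "Complex r r"]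
  unfolding terrain_def inside_boundary_square by (auto simp: boundary_square frontier_cbox)

text \<open>A boundary point has a coordinate of absolute value at least \<open>r\<close>. It
  differs from the same coordinate of the start by at least \<open>r - d\<close> if it is the real
  part, and by at least \<open>r\<close> otherwise.\<close>

lemma boundary_square_far:
  assumes "z \<in> boundary (square r)" "0 \<le> d" "d \<le> r"
  shows "r - d \<le> dist (Complex d 0) z"
proof -
  have "r \<le> \<bar>Re z\<bar> \<or> r \<le> \<bar>Im z\<bar>"
    using assms(1)
    by (auto simp: boundary_square frontier_cbox in_cbox_complex_iff in_box_complex_iff)
  then show ?thesis
    using abs_Re_le_cmod[of "Complex d 0 - z"] abs_Im_le_cmod[of "Complex d 0 - z"] assms(2,3)
    by (auto simp: dist_norm)
qed

end

theorem theorem3p2: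
  "\<exists>c>0. \<forall>P0::real. \<exists>T. simple_polygon T \<and> P0 \<le> perimeter T \<and>
     (\<forall>F A D. coherent_compasses F \<and> rendezvous_algorithm F A \<and> 0 < D \<and>
        (\<exists>x\<in>terrain T. \<exists>y\<in>terrain T. terrain_dist T x y = ereal D) \<longrightarrow>
        ereal (c * perimeter T) \<le> cost F A T D)"
proof (intro exI[of _ "1 / 16"] conjI allI)
  fix P0 :: real
  \<comment> \<open>The maximum keeps \<open>r\<close> positive even if \<open>P0\<close> is
    not.\<close>
  define r where "r = max 1 P0"
  define T where "T = square r"
  have r: "0 < r" "P0 \<le> r" by (auto simp: r_def)
  have T: "simple_polygon T" unfolding T_def by (rule simple_polygon_square[OF r(1)])
  have per: "perimeter T = 8 * r" unfolding T_def by (rule perimeter_square[OF r(1)])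
  have dist: "terrain_dist T x y = ereal (dist x y)" if "x \<in> terrain T" "y \<in> terrain T" for x y
    using that by (intro terrain_dist_convex) (simp_all add: T_def terrain_square[OF r(1)])
  \<comment> \<open>The perimeter is \<open>8 * r\<close>, so \<open>r / 2\<close> is the fraction
    1/16 of it.\<close>
  have "ereal (r / 2) \<le> cost F A T D"
    if F: "coherent_compasses F" and A: "rendezvous_algorithm F A" and D: "0 < D"
      and xy: "x \<in> terrain T" "y \<in> terrain T" "terrain_dist T x y = ereal D" for F A D x y
  proof -
    obtain f where f: "(f, f) \<in> F" using F by (auto simp: coherent_compasses_def)
    show ?thesis
    proof (cases "D < r / 2")
      case True
      \<comment> \<open>The agents start at 0 and \<open>D\<close> on the real axis. As
        \<open>D < r / 2\<close>, both are at distance at least \<open>r / 2\<close> from the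
        boundary.\<close>
      have ins: "Complex d 0 \<in> inside (boundary T)" if "0 \<le> d" "d < r" for d
        using that by (simp add: T_def inside_boundary_square[OF r(1)] in_box_complex_iff)
      have far: "r / 2 \<le> dist (Complex d 0) z" if "z \<in> boundary T" "0 \<le> d" "d < r / 2" for d z
        using boundary_square_far[OF r(1), of z d] that by (simp add: T_def)
      have in0: "Complex 0 0 \<in> inside (boundary T)" and inD: "Complex D 0 \<in> inside (boundary T)"
        using ins True D r(1) by auto
      have "dist (Complex 0 0) (Complex D 0) = D" using D by (simp add: dist_norm cmod_def)
      then have "terrain_dist T (Complex 0 0) (Complex D 0) = ereal D"
        using dist in0 inD by (simp add: terrain_def)
      then show ?thesis
        using far True D r(1) by (intro cost_ge_boundary_distance[OF A f T in0 inD]) auto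
    next
      case False
      \<comment> \<open>For large \<open>D\<close> the starting points are the pair at distance
        \<open>D\<close> whose existence is assumed.\<close>
      have "dist x y = D" using xy dist by simp
      then have "ereal D \<le> cost F A T D"
        using cost_ge_dist[OF A f T xy(1,2) _ xy(3)] D by auto
      moreover have "ereal (r / 2) \<le> ereal D" using False by simp
      ultimately show ?thesis by (rule order_trans[rotated])
    qed
  qed
  then show "\<exists>T. simple_polygon T \<and> P0 \<le> perimeter T \<and>
     (\<forall>F A D. coherent_compasses F \<and> rendezvous_algorithm F A \<and> 0 < D \<and>
        (\<exists>x\<in>terrain T. \<exists>y\<in>terrain T. terrain_dist T x y = ereal D) \<longrightarrow>
        ereal (1 / 16 * perimeter T) \<le> cost F A T D)"
    using T per r by (intro exI[of _ T]) auto
qed simp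

end
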